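(* Let $\mu\in\mathbb{C}$ and let $m\ge0$, $n\ge1$ be integers. Then the rational function $$\sigma(z)=z\frac{d}{dz}\ln\left\{T_{m,n}^{(\mu)}(z)\right\}-(m+1)n$$ is a solution of the $\mathrm{P_V}$ $\sigma$-equation $$\left(z\frac{d^2\sigma}{dz^2}\right)^2=\left[2\left(\frac{d\sigma}{dz}\right)^2+(\nu_1+\nu_2+\nu_3-z)\frac{d\sigma}{dz}+\sigma\right]^2-4\frac{d\sigma}{dz}\prod_{j=1}^3\left(\frac{d\sigma}{dz}+\nu_j\right)$$ with parameters $(\nu_1,\nu_2,\nu_3)=(m+1,\,-n,\,m+n+\mu+1)$.
   Context: $L_n^{(\alpha)}(z)=\sum_{i=0}^n \frac{(-1)^i}{i!\,(n-i)!}\Big(\prod_{l=i+1}^{n}(\alpha+l)\Big)z^i$ is the associated Laguerre polynomial ($n\ge0$, any complex $\alpha$). The generalised Laguerre polynomial is $T_{m,n}^{(\mu)}(z)=\det\left[\frac{d^{j+k}}{dz^{j+k}}L_{m+n}^{(\mu+1)}(z)\right]_{j,k=0}^{n-1}$ for integers $m\ge0$, $n\ge1$. *)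

theory Defs
  imports "HOL-Analysis.Analysis" "Jordan_Normal_Form.Determinant"
begin

definition laguerre :: "nat \<Rightarrow> complex \<Rightarrow> complex poly" where
  "laguerre n \<alpha> =
     (\<Sum>i=0..n. monom ((-1) ^ i / (fact i * fact (n - i)) * (\<Prod>l=i+1..n. \<alpha> + of_nat l)) i)"

definition gen_laguerre :: "nat \<Rightarrow> nat \<Rightarrow> complex \<Rightarrow> complex poly" where
  "gen_laguerre m n \<mu> =
     Determinant.det (mat n n (\<lambda>(j, k). (pderiv ^^ (j + k)) (laguerre (m + n) (\<mu> + 1))))"

(* The term z d/dz ln T is the logarithmic derivative z T'/T, so no branch of the logarithm is
   involved. At a zero of T, division by zero makes the value meaningless. *)
definition sigma_fun :: "nat \<Rightarrow> nat \<Rightarrow> complex \<Rightarrow> complex \<Rightarrow> complex" where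
  "sigma_fun m n \<mu> z =
     z * (poly (pderiv (gen_laguerre m n \<mu>)) z / poly (gen_laguerre m n \<mu>) z)
       - (of_nat m + 1) * of_nat n"

definition PV_sigma_solution_on ::
    "complex \<Rightarrow> complex \<Rightarrow> complex \<Rightarrow> (complex \<Rightarrow> complex) \<Rightarrow> complex set \<Rightarrow> bool" where
  "PV_sigma_solution_on \<nu>\<^sub>1 \<nu>\<^sub>2 \<nu>\<^sub>3 \<sigma> S \<longleftrightarrow>
     open S \<and> \<sigma> holomorphic_on S \<and>
     (\<forall>z\<in>S. (z * deriv (deriv \<sigma>) z)\<^sup>2 =
        (2 * (deriv \<sigma> z)\<^sup>2 + (\<nu>\<^sub>1 + \<nu>\<^sub>2 + \<nu>\<^sub>3 - z) * deriv \<sigma> z + \<sigma> z)\<^sup>2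
        - 4 * deriv \<sigma> z * ((deriv \<sigma> z + \<nu>\<^sub>1) * (deriv \<sigma> z + \<nu>\<^sub>2) * (deriv \<sigma> z + \<nu>\<^sub>3)))"

end

(* T_k = hankel_tau w k is the Hankel determinant of the "moments" w^(j), so the Desnanot-Jacobi
   identity gives the Toda equation T_(k+1) T_(k-1) = T_k T_k'' - T_k'^2.  Comparing leading
   coefficients in it shows that deg T_k = k (N + 1 - k) for a w of degree N, so that T_k is nonzero
   for k <= N + 1.  With s_k = T_k'/T_k, a_k = s_(k+1) - s_k and b_k = T_(k+1) T_(k-1) / T_k^2, the
   Toda flow is s_k' = b_k and b_k' = b_k (a_k - a_(k-1)).  If w satisfies the Laguerre equation,
   two Laguerre-Freud relations between a_k, b_k, b_(k+1), s_k hold: differentiating the first at k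
   yields the second at k+1, whose derivative yields the first at k+1.  They imply by induction a
   third relation without differentiation, and eliminating a_n from the last two at k = n is the
   sigma equation.  This argument needs T_0, ..., T_(n+1) and z to be nonzero, which excludes only
   finitely many points; the remaining ones follow by continuity. *)

theory Submission
  imports Defs "Jordan_Normal_Form.Char_Poly" "HOL-Complex_Analysis.Cauchy_Integral_Formula"
begin

section \<open>Desnanot-Jacobi identity\<close>

abbreviation det_fun :: "nat \<Rightarrow> (nat \<Rightarrow> nat \<Rightarrow> 'a::comm_ring_1) \<Rightarrow> 'a" where
  "det_fun n f \<equiv> Determinant.det (mat n n (\<lambda>(i, j). f i j))"

text \<open>On 0, ..., n this lists the indices 0, ..., n-1, n+1, as left after deleting row or
  column \<open>n\<close> from a matrix of size n+2.\<close>

definition bump :: "nat \<Rightarrow> nat \<Rightarrow> nat" where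
  "bump n i = (if i = n then Suc n else i)"

lemma det_2_by_2:
  fixes A :: "'a::comm_ring_1 mat"
  assumes A: "A \<in> carrier_mat 2 2"
  shows "Determinant.det A = A $$ (0,0) * A $$ (1,1) - A $$ (0,1) * A $$ (1,0)"
  by (subst laplace_expansion_row[OF A, of 0])
    (use A in \<open>simp_all add: cofactor_def numeral_2_eq_2 det_single mat_delete_def\<close>)

text \<open>The matrix \<open>B\<close> is the identity with its last two columns replaced by those of the adjugate of \<open>A\<close>.\<close>

lemma desnanot_jacobi_nonsingular:
  fixes f :: "nat \<Rightarrow> nat \<Rightarrow> 'a::idom"
  assumes nz: "det_fun (Suc (Suc n)) f \<noteq> 0"
  shows "det_fun (Suc (Suc n)) f * det_fun n f =
    det_fun (Suc n) f * det_fun (Suc n) (\<lambda>i j. f (bump n i) (bump n j))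
    - det_fun (Suc n) (\<lambda>i j. f (bump n i) j) * det_fun (Suc n) (\<lambda>i j. f i (bump n j))"
proof -
  define A where "A = mat (n+2) (n+2) (\<lambda>(i, j). f i j)"
  define d where "d = Determinant.det A"
  have A: "A \<in> carrier_mat (n+2) (n+2)" by (simp add: A_def)
  define P where "P = mat n 2 (\<lambda>(i, j). cofactor A (n + j) i)"
  define C where "C = mat 2 2 (\<lambda>(i, j). cofactor A (n + j) (n + i))"
  define B where "B = four_block_mat (1\<^sub>m n) P (0\<^sub>m 2 n) C"
  define A1 where "A1 = mat n n (\<lambda>(i, j). f i j)"
  define A3 where "A3 = mat 2 n (\<lambda>(i, j). f (n + i) j)"
  have B: "B \<in> carrier_mat (n+2) (n+2)" by (auto simp: B_def P_def C_def)
  have detB: "Determinant.det B = Determinant.det C"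
    unfolding B_def by (subst det_four_block_mat_lower_left_zero[of _ n _ 2]) (auto simp: P_def C_def)
  \<comment> \<open>The first \<open>n\<close> columns of \<open>B\<close> are unit vectors and copy
    those of \<open>A\<close>; the last two are adjugate columns, which \<open>A\<close> maps to
    \<open>d\<close> times unit vectors.\<close>
  have prod: "A * B = four_block_mat A1 (0\<^sub>m n 2) A3 (d \<cdot>\<^sub>m 1\<^sub>m 2)"
  proof (rule eq_matI)
    fix i j assume "i < dim_row (four_block_mat A1 (0\<^sub>m n 2) A3 (d \<cdot>\<^sub>m 1\<^sub>m 2))"
      "j < dim_col (four_block_mat A1 (0\<^sub>m n 2) A3 (d \<cdot>\<^sub>m 1\<^sub>m 2))"
    then have ij: "i < n + 2" "j < n + 2" by (auto simp: A1_def)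
    show "(A * B) $$ (i, j) = four_block_mat A1 (0\<^sub>m n 2) A3 (d \<cdot>\<^sub>m 1\<^sub>m 2) $$ (i, j)"
    proof (cases "j < n")
      case True
      have "(A * B) $$ (i, j) = (\<Sum>k = 0..<n+2. f i k * B $$ (k, j))"
        using ij B by (simp add: scalar_prod_def A_def)
      also have "\<dots> = (\<Sum>k = 0..<n+2. if k = j then f i k else 0)"
        using True by (intro sum.cong) (auto simp: B_def P_def C_def)
      also have "\<dots> = f i j" using ij by simp
      finally show ?thesis using True ij by (auto simp: A1_def A3_def)
    next
      case False
      have "(A * B) $$ (i, j) = (\<Sum>k = 0..<n+2. A $$ (i, k) * cofactor A j k)"
        using ij False B A by (auto simp: scalar_prod_def B_def P_def C_def intro!: sum.cong)
      also have "\<dots> = (A * adj_mat A) $$ (i, j)"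
        using ij A by (simp add: scalar_prod_def adj_mat_def)
      also have "\<dots> = (if i = j then d else 0)"
        using ij unfolding adj_mat(2)[OF A] by (auto simp: d_def)
      finally show ?thesis using False ij by (auto simp: A1_def)
    qed
  qed (use A B in \<open>auto simp: A1_def\<close>)
  have "d * Determinant.det C = Determinant.det (A * B)"
    using det_mult[OF A B] detB by (simp add: d_def)
  also have "\<dots> = Determinant.det A1 * d\<^sup>2"
    unfolding prod by (subst det_four_block_mat_upper_right_zero[of _ n _ 2])
      (auto simp: A1_def A3_def)
  \<comment> \<open>Nonsingularity enters here, to cancel one factor \<open>d\<close>.\<close>
  finally have "Determinant.det C = d * Determinant.det A1"
    using nz by (simp add: power2_eq_square d_def A_def)
  moreover have del: "Determinant.det (mat_delete A (n + k) (n + l)) =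
      det_fun (Suc n) (\<lambda>i j. f (if k = 0 then bump n i else i) (if l = 0 then bump n j else j))"
    if "k < 2" "l < 2" for k l
    by (rule arg_cong[of _ _ "Determinant.det"], rule eq_matI)
      (use that in \<open>auto simp: mat_delete_def A_def bump_def less_2_cases_iff\<close>)
  moreover have "Determinant.det C =
      cofactor A n n * cofactor A (Suc n) (Suc n) - cofactor A (Suc n) n * cofactor A n (Suc n)"
    by (subst det_2_by_2) (auto simp: C_def)
  ultimately show ?thesis
    using del[of 0 0] del[of 0 1] del[of 1 0] del[of 1 1]
    by (simp add: cofactor_def d_def A_def A1_def mult_ac)
qed

lemma poly_det_fun: "poly (det_fun n f) x = det_fun n (\<lambda>i j. poly (f i j) x)"
  by (rule poly_det_cong[of _ n]) auto

text \<open>Specialise the nonsingular matrix \<open>X\<cdot>1 + f\<close> at \<open>X = 0\<close>.\<close>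

lemma desnanot_jacobi:
  fixes f :: "nat \<Rightarrow> nat \<Rightarrow> 'a::idom"
  shows "det_fun (Suc (Suc n)) f * det_fun n f =
    det_fun (Suc n) f * det_fun (Suc n) (\<lambda>i j. f (bump n i) (bump n j))
    - det_fun (Suc n) (\<lambda>i j. f (bump n i) j) * det_fun (Suc n) (\<lambda>i j. f i (bump n j))"
proof -
  define g where "g i j = (if i = j then [:0, 1:] else 0) + [:f i j:]" for i j
  have g0: "poly (g i j) 0 = f i j" for i j by (simp add: g_def)
  let ?N = "Suc (Suc n)"
  let ?A = "mat ?N ?N (\<lambda>(i, j). - f i j)"
  \<comment> \<open>X*1 + f is the characteristic matrix of -f, so its determinant is monic and
    hence nonzero.\<close>
  have "mat ?N ?N (\<lambda>(i, j). g i j) = char_poly_matrix ?A"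
    by (rule eq_matI) (auto simp: char_poly_matrix_def g_def)
  then have "det_fun ?N g = char_poly ?A" by (simp add: char_poly_def)
  moreover have "char_poly ?A \<noteq> 0"
    using degree_monic_char_poly[of ?A ?N] by auto
  ultimately have "det_fun ?N g \<noteq> 0" by simp
  from arg_cong[OF desnanot_jacobi_nonsingular[OF this], of "\<lambda>p. poly p 0"]
  show ?thesis by (simp only: poly_mult poly_diff poly_det_fun g0)
qed

section \<open>Derivatives of Hankel determinants and the Toda equation\<close>

lemma det_fun_transpose: "det_fun n f = det_fun n (\<lambda>i j. f j i)"
proof -
  have "mat n n (\<lambda>(i, j). f j i) = transpose_mat (mat n n (\<lambda>(i, j). f i j))" by (rule eq_matI) auto
  then show ?thesis using det_transpose[of "mat n n (\<lambda>(i, j). f i j)" n] by simp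
qed

lemma pderiv_det_fun:
  fixes f :: "nat \<Rightarrow> nat \<Rightarrow> 'a::idom poly"
  shows "pderiv (det_fun n f) = (\<Sum>r<n. det_fun n (\<lambda>i j. if i = r then pderiv (f i j) else f i j))"
proof -
  have sgn: "pderiv (signof p * q) = signof p * pderiv q" for p :: "nat \<Rightarrow> nat" and q :: "'a poly"
    by (cases p rule: sign_cases) (simp_all add: pderiv_minus)
  have detf: "det_fun n h = (\<Sum>p | p permutes {0..<n}. signof p * (\<Prod>i = 0..<n. h i (p i)))"
    for h :: "nat \<Rightarrow> nat \<Rightarrow> 'a poly"
    by (subst det_def'[of _ n]) (auto intro!: sum.cong prod.cong simp: permutes_in_image[of _ "{0..<n}", simplified])
  have "pderiv (det_fun n f) = (\<Sum>p | p permutes {0..<n}. \<Sum>r<n.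
      signof p * (\<Prod>i = 0..<n. if i = r then pderiv (f i (p i)) else f i (p i)))"
    unfolding detf pderiv_sum sgn pderiv_prod sum_distrib_left atLeast0LessThan[symmetric]
  proof (intro sum.cong refl)
    fix p r assume r: "r \<in> {0..<n}"
    have "(\<Prod>i = 0..<n. if i = r then pderiv (f i (p i)) else f i (p i)) =
        pderiv (f r (p r)) * (\<Prod>i \<in> {0..<n} - {r}. if i = r then pderiv (f i (p i)) else f i (p i))"
      using r by (subst prod.remove[of _ r]) auto
    also have "(\<Prod>i \<in> {0..<n} - {r}. if i = r then pderiv (f i (p i)) else f i (p i)) =
        (\<Prod>i \<in> {0..<n} - {r}. f i (p i))"
      by (intro prod.cong) auto
    finally show "signof p * ((\<Prod>i \<in> {0..<n} - {r}. f i (p i)) * pderiv (f r (p r))) =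
        signof p * (\<Prod>i = 0..<n. if i = r then pderiv (f i (p i)) else f i (p i))"
      by (simp add: mult.commute)
  qed
  also have "\<dots> = (\<Sum>r<n. det_fun n (\<lambda>i j. if i = r then pderiv (f i j) else f i j))"
    unfolding detf by (rule sum.swap)
  finally show ?thesis .
qed

text \<open>Differentiating row \<open>r < n\<close> makes it equal to row r+1, so only the last row
  contributes, moving from index n to n+1. The free column shift \<open>\<tau>\<close> permits a
  second use once the columns are shifted.\<close>

lemma pderiv_det_fun_higher_pderiv:
  fixes w :: "'a::idom poly"
  shows "pderiv (det_fun (Suc n) (\<lambda>i j. (pderiv ^^ (i + \<tau> j)) w)) =
    det_fun (Suc n) (\<lambda>i j. (pderiv ^^ (bump n i + \<tau> j)) w)"
proof -
  have zero: "det_fun (Suc n) (\<lambda>i j. if i = r then pderiv ((pderiv ^^ (i + \<tau> j)) w) else (pderiv ^^ (i + \<tau> j)) w) = 0"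
    if "r < n" for r
    by (rule det_identical_rows[of _ "Suc n" r "Suc r"]) (use that in \<open>auto intro!: eq_vecI\<close>)
  show ?thesis
    unfolding pderiv_det_fun sum.lessThan_Suc
    using zero by (auto intro!: arg_cong[of _ _ Determinant.det] eq_matI simp: bump_def)
qed

text \<open>For w = L_(m+n)^(mu+1) only size \<open>n\<close> is T_(m,n); the other sizes, with the
  same \<open>w\<close>, are its neighbours in the Toda equation.\<close>

definition hankel_tau :: "'a::idom poly \<Rightarrow> nat \<Rightarrow> 'a poly" where
  "hankel_tau w n = det_fun n (\<lambda>i j. (pderiv ^^ (i + j)) w)"

lemma hankel_tau_toda:
  "hankel_tau w (Suc (Suc n)) * hankel_tau w n =
    hankel_tau w (Suc n) * pderiv (pderiv (hankel_tau w (Suc n))) - (pderiv (hankel_tau w (Suc n)))\<^sup>2"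
proof -
  have d1: "pderiv (hankel_tau w (Suc n)) = det_fun (Suc n) (\<lambda>i j. (pderiv ^^ (bump n i + j)) w)"
    unfolding hankel_tau_def by (rule pderiv_det_fun_higher_pderiv)
  also have "\<dots> = det_fun (Suc n) (\<lambda>i j. (pderiv ^^ (i + bump n j)) w)"
    by (subst det_fun_transpose) (simp add: add.commute)
  finally have d2: "pderiv (hankel_tau w (Suc n)) = det_fun (Suc n) (\<lambda>i j. (pderiv ^^ (i + bump n j)) w)" .
  have d3: "pderiv (pderiv (hankel_tau w (Suc n))) =
      det_fun (Suc n) (\<lambda>i j. (pderiv ^^ (bump n i + bump n j)) w)"
    unfolding d2 by (rule pderiv_det_fun_higher_pderiv)
  show ?thesis
    \<comment> \<open>The two factors of the square are read as different minors, one with shifted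
      rows, the other with shifted columns.\<close>
    unfolding d3 power2_eq_square
    by (subst (1) d1, subst d2) (unfold hankel_tau_def, rule desnanot_jacobi)
qed

lemma hankel_tau_0 [simp]: "hankel_tau w 0 = 1"
  by (simp add: hankel_tau_def)

lemma hankel_tau_1 [simp]: "hankel_tau w (Suc 0) = w"
  by (simp add: hankel_tau_def det_single)

section \<open>Degrees of the Hankel determinants\<close>

lemma coeff_mult_at_bounds:
  fixes p q :: "'a::comm_semiring_1 poly"
  assumes "degree p \<le> k" "degree q \<le> l"
  shows "coeff (p * q) (k + l) = coeff p k * coeff q l"
proof -
  have "coeff p i * coeff q (k + l - i) = 0" if "i \<le> k + l" "i \<noteq> k" for i
  proof (cases "i < k")
    case True
    then show ?thesis using assms by (simp add: coeff_eq_0)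
  next
    case False
    then show ?thesis using assms that by (simp add: coeff_eq_0)
  qed
  then have "(\<Sum>i\<le>k + l. coeff p i * coeff q (k + l - i)) = (\<Sum>i\<in>{k}. coeff p i * coeff q (k + l - i))"
    by (intro sum.mono_neutral_right) auto
  then show ?thesis by (simp add: coeff_mult)
qed

text \<open>With leading coefficient c, the coefficient of z^(2d) is (d+1)d c^2 - (d+1)^2 c^2 =
  -(d+1) c^2, nonzero in characteristic 0.\<close>

lemma toda_bilinear_degree:
  fixes p :: "'a::{idom,ring_char_0} poly"
  assumes d: "degree p = Suc d"
  defines "q \<equiv> p * pderiv (pderiv p) - (pderiv p)\<^sup>2"
  shows "q \<noteq> 0" "degree q = 2 * d"
proof -
  let ?c = "lead_coeff p"
  have c: "?c \<noteq> 0" using d by (metis leading_coeff_0_iff degree_0 Zero_not_Suc)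
  have dp: "degree (pderiv p) = d" by (simp add: degree_pderiv d)
  have p2: "coeff (p * pderiv (pderiv p)) (2 * d) = of_nat (Suc d) * of_nat d * ?c\<^sup>2
      \<and> degree (p * pderiv (pderiv p)) \<le> 2 * d"
  proof (cases d)
    case 0
    then have "pderiv (pderiv p) = 0" using dp by (simp add: pderiv_eq_0_iff)
    then show ?thesis using 0 by simp
  next
    case (Suc e)
    have de: "degree (pderiv (pderiv p)) = e" by (subst degree_pderiv) (simp add: dp Suc)
    have e: "2 * d = Suc d + e" using Suc by simp
    have "coeff (p * pderiv (pderiv p)) (Suc d + e) = coeff p (Suc d) * coeff (pderiv (pderiv p)) e"
      by (rule coeff_mult_at_bounds) (use d de in auto)
    also have "\<dots> = of_nat (Suc d) * of_nat d * ?c\<^sup>2"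
      by (simp add: d Suc coeff_pderiv power2_eq_square mult_ac)
    finally show ?thesis
      unfolding e using degree_mult_le[of p "pderiv (pderiv p)"] d de by simp
  qed
  have p1: "coeff ((pderiv p)\<^sup>2) (d + d) = (of_nat (Suc d) * ?c)\<^sup>2"
    unfolding power2_eq_square by (subst coeff_mult_at_bounds) (use d dp in \<open>auto simp: coeff_pderiv\<close>)
  have p1': "degree ((pderiv p)\<^sup>2) \<le> 2 * d"
    using degree_mult_le[of "pderiv p" "pderiv p"] dp by (simp add: power2_eq_square)
  have "coeff q (2 * d) = of_nat (Suc d) * of_nat d * ?c\<^sup>2 - (of_nat (Suc d) * ?c)\<^sup>2"
    using p1 p2 by (simp only: q_def coeff_diff mult_2)
  also have "\<dots> = - of_nat (Suc d) * ?c\<^sup>2"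
    by (simp add: power2_eq_square algebra_simps)
  finally have "coeff q (2 * d) = - of_nat (Suc d) * ?c\<^sup>2" .
  then have nz: "coeff q (2 * d) \<noteq> 0" using c by (simp del: of_nat_Suc)
  then show "q \<noteq> 0" by auto
  have "degree q \<le> 2 * d" unfolding q_def using p2 p1' by (simp add: degree_diff_le)
  with nz show "degree q = 2 * d" using le_degree by (metis le_antisym)
qed

text \<open>The Toda equation gives the sum of the degrees at sizes n and n+2. The bound by
  \<open>Suc N\<close> keeps the determinant between them of positive degree, as
  \<open>toda_bilinear_degree\<close> requires.\<close>

lemma hankel_tau_degree:
  fixes w :: "'a::{idom,ring_char_0} poly"
  assumes w: "degree w = N" "w \<noteq> 0" and n: "n \<le> Suc N"
  shows "hankel_tau w n \<noteq> 0 \<and> degree (hankel_tau w n) = n * (Suc N - n)"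
  using n
proof (induction n rule: induct_nat_012)
  case (ge2 n)
  then obtain e where e: "N = Suc n + e" using le_Suc_ex by (metis Suc_le_mono)
  define q where "q = hankel_tau w (Suc n) * pderiv (pderiv (hankel_tau w (Suc n))) - (pderiv (hankel_tau w (Suc n)))\<^sup>2"
  have "degree (hankel_tau w (Suc n)) = Suc (n * e + n + e)"
    using ge2 e by simp
  from toda_bilinear_degree[OF this] have q: "q \<noteq> 0" "degree q = 2 * (n * e + n + e)"
    by (auto simp: q_def)
  have prod: "hankel_tau w (Suc (Suc n)) * hankel_tau w n = q"
    unfolding q_def by (rule hankel_tau_toda)
  then have nz: "hankel_tau w (Suc (Suc n)) \<noteq> 0" "hankel_tau w n \<noteq> 0" using q by auto
  have "degree (hankel_tau w (Suc (Suc n))) + degree (hankel_tau w n) = 2 * (n * e + n + e)"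
    using degree_mult_eq[OF nz] prod q by simp
  moreover have "degree (hankel_tau w n) = n * (e + 2)" using ge2 e by simp
  ultimately show ?case using nz e by (simp add: algebra_simps)
qed (use w in auto)


section \<open>Toda flow and Laguerre-Freud relations\<close>

lemma DERIV_zero_on_open:
  assumes "open D" "z \<in> D" "\<And>x. x \<in> D \<Longrightarrow> F x = 0" "(F has_field_derivative E) (at z)"
  shows "E = 0"
proof -
  have "(F has_field_derivative 0) (at z)"
    by (rule has_field_derivative_transform_within_open[of "\<lambda>_. 0" _ _ D]) (use assms in auto)
  then show ?thesis using assms(4) DERIV_unique by blast
qed

text \<open>Only the Toda flow and the Laguerre equation remain of the determinants: in the intended
  instance \<open>a 0\<close> is w'/w, and \<open>b 1\<close> plus its square is w''/w.
  \<open>b'\<close> is separate data because the Toda formula at index 0 would mention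
  a_(-1).\<close>

locale laguerre_toda =
  fixes D :: "complex set" and s a b b' :: "nat \<Rightarrow> complex \<Rightarrow> complex"
    and \<alpha> N :: complex and n :: nat
  assumes open_D: "open D" and nz: "\<And>z. z \<in> D \<Longrightarrow> z \<noteq> 0"
    and s_deriv: "\<And>k z. k \<le> n \<Longrightarrow> z \<in> D \<Longrightarrow> (s k has_field_derivative b k z) (at z)"
    and b_deriv: "\<And>k z. k \<le> n \<Longrightarrow> z \<in> D \<Longrightarrow> (b k has_field_derivative b' k z) (at z)"
    and a_def: "\<And>k z. a k z = s (Suc k) z - s k z"
    and b'_Suc: "\<And>k z. Suc k \<le> n \<Longrightarrow> z \<in> D \<Longrightarrow> b' (Suc k) z = b (Suc k) z * (a (Suc k) z - a k z)"
    and b_nz: "\<And>k z. Suc k \<le> n \<Longrightarrow> z \<in> D \<Longrightarrow> b (Suc k) z \<noteq> 0"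
    and s0: "\<And>z. s 0 z = 0" and b0: "\<And>z. b 0 z = 0" and b'0: "\<And>z. b' 0 z = 0"
    and riccati: "\<And>z. z \<in> D \<Longrightarrow> z * (b 1 z + (a 0 z)\<^sup>2) + (\<alpha> + 1 - z) * a 0 z + N = 0"
begin

text \<open>
  Let \<open>P\<^sub>k\<close> be the monic orthogonal polynomials for the functional with moments \<open>w\<^sup>(\<^sup>j\<^sup>)(z)\<close>; their
  recurrence coefficients are \<open>a\<^sub>k\<close> and \<open>b\<^sub>k\<close>.  By the equation for \<open>w\<close>, the functional annihilates
  \<open>(x\<^sup>2 - x) p' + (z x\<^sup>2 + (\<alpha> + 1 - z) x + N) p\<close>; \<open>freud1\<close> and \<open>freud2\<close> come from
  \<open>p = P\<^sub>k\<^sup>2\<close> and \<open>p = P\<^sub>k P\<^sub>k\<^sub>-\<^sub>1\<close>, and \<open>residue_det\<close> from the determinant of the residue at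
  \<open>x = 1\<close> of the differential system for \<open>(P\<^sub>k, P\<^sub>k\<^sub>-\<^sub>1)\<close>.  Writing \<open>freud2\<close> and \<open>residue_det\<close> with \<open>b'\<close>
  in place of \<open>a\<^sub>k\<^sub>-\<^sub>1\<close> makes them meaningful for \<open>k = 0\<close>.
\<close>

definition freud1 :: "nat \<Rightarrow> complex \<Rightarrow> complex" where
  "freud1 k z = 2 * (s k z + of_nat k * a k z - of_nat k) + z * ((a k z)\<^sup>2 + b k z + b (Suc k) z)
     + (\<alpha> + 1 - z) * a k z + N"

definition freud2 :: "nat \<Rightarrow> complex \<Rightarrow> complex" where
  "freud2 k z = z * (b k z * (2 * z * a k z + \<alpha> + 2 * of_nat k - 1 - z) - z * b' k z)
     - ((\<alpha> + 2 * of_nat k - 1) * s k z + of_nat k * (N - of_nat k + 1))"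

definition residue_det :: "nat \<Rightarrow> complex \<Rightarrow> complex" where
  "residue_det k z = (z * a k z + \<alpha> + 2 * of_nat k) * (b k z * (z * a k z + \<alpha> + 2 * of_nat k - 2) - z * b' k z)
     - (s k z + z * b k z) * (s k z + z * b k z + N + \<alpha>)"

lemma a_deriv:
  assumes "Suc k \<le> n" "z \<in> D"
  shows "(a k has_field_derivative b (Suc k) z - b k z) (at z)"
proof -
  have "((\<lambda>z. s (Suc k) z - s k z) has_field_derivative b (Suc k) z - b k z) (at z)"
    using assms by (intro DERIV_diff s_deriv) auto
  then show ?thesis using a_def by presburger
qed

text \<open>By the Toda formula, \<open>freud2 (Suc k)\<close> is \<open>freud2 k\<close> plus z
  times the derivative of \<open>freud1 k\<close> minus \<open>freud1 k\<close>. The terms in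
  \<open>b' k\<close> cancel, so k = 0 is covered.\<close>

lemma freud2_Suc:
  assumes k: "Suc k \<le> n" and z: "z \<in> D"
    and freud1: "\<And>z. z \<in> D \<Longrightarrow> freud1 k z = 0" and freud2: "freud2 k z = 0"
  shows "freud2 (Suc k) z = 0"
proof -
  let ?E = "2 * (b k z + of_nat k * (b (Suc k) z - b k z))
    + (((a k z)\<^sup>2 + b k z + b (Suc k) z) + z * (2 * a k z * (b (Suc k) z - b k z) + b' k z + b' (Suc k) z))
    + ((\<alpha> + 1 - z) * (b (Suc k) z - b k z) - a k z)"
  have "(freud1 k has_field_derivative ?E) (at z)"
    unfolding freud1_def
    by (rule derivative_eq_intros a_deriv s_deriv b_deriv refl | use k z in simp)+
  then have E: "?E = 0"
    using DERIV_zero_on_open[of D z "freud1 k"] open_D z freud1 by blast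
  have "a k z = s (Suc k) z - s k z" by (rule a_def)
  then have sS: "s (Suc k) z = s k z + a k z" by simp
  have "freud2 (Suc k) z = freud2 k z + z * (?E) - freud1 k z"
    unfolding freud1_def freud2_def sS b'_Suc[OF k z] by (simp add: algebra_simps power2_eq_square)
  then show ?thesis using E freud1[OF z] freud2 by simp
qed

text \<open>The derivative of \<open>freud2 (Suc k)\<close> is z b_(k+1) times the difference of
  \<open>freud1\<close> at k+1 and k. The bound on k supplies the derivative of
  \<open>a (Suc k)\<close>.\<close>

lemma freud1_Suc:
  assumes k: "Suc (Suc k) \<le> n" and z: "z \<in> D"
    and freud1: "freud1 k z = 0" and freud2: "\<And>z. z \<in> D \<Longrightarrow> freud2 (Suc k) z = 0"
  shows "freud1 (Suc k) z = 0"
proof -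
  have k': "Suc k \<le> n" using k by simp
  \<comment> \<open>Replacing \<open>b'\<close> in \<open>freud2 (Suc k)\<close> by the Toda formula
    avoids a second derivative of \<open>b\<close>.\<close>
  define F where "F z = z * (b (Suc k) z * (z * (a (Suc k) z + a k z) + \<alpha> + 2 * of_nat k + 1 - z))
     - ((\<alpha> + 2 * of_nat k + 1) * s (Suc k) z + of_nat (Suc k) * (N - of_nat k))" for z
  have F0: "F z = 0" if "z \<in> D" for z
    using freud2[OF that] unfolding freud2_def F_def b'_Suc[OF k' that] by (simp add: algebra_simps)
  let ?E = "b (Suc k) z * (z * (a (Suc k) z + a k z) + \<alpha> + 2 * of_nat k + 1 - z)
     + z * (b' (Suc k) z * (z * (a (Suc k) z + a k z) + \<alpha> + 2 * of_nat k + 1 - z)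
       + b (Suc k) z * ((a (Suc k) z + a k z) + z * (b (Suc (Suc k)) z - b k z) - 1))
     - (\<alpha> + 2 * of_nat k + 1) * b (Suc k) z"
  have "(F has_field_derivative ?E) (at z)"
    unfolding F_def
    by (rule derivative_eq_intros a_deriv s_deriv b_deriv refl | use k k' z in \<open>simp add: algebra_simps\<close>)+
  then have E: "?E = 0"
    using DERIV_zero_on_open[of D z F] open_D z F0 by blast
  have "a k z = s (Suc k) z - s k z" by (rule a_def)
  then have sS: "s (Suc k) z = s k z + a k z" by simp
  have "z * b (Suc k) z * (freud1 (Suc k) z - freud1 k z) = ?E"
    unfolding freud1_def sS b'_Suc[OF k' z] by (simp add: algebra_simps power2_eq_square)
  then show ?thesis using E freud1 nz[OF z] b_nz[OF k' z] by simp
qed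

text \<open>Climbs from \<open>freud1 k\<close> to \<open>freud2 (Suc k)\<close> to
  \<open>freud1 (Suc k)\<close>, starting from the Riccati equation. \<open>freud1_Suc\<close>
  reaches only index n-1, since \<open>s n\<close> is the last function with a known
  derivative.\<close>

lemma freud1_freud2:
  "k \<le> n \<Longrightarrow> (k < n \<longrightarrow> (\<forall>z\<in>D. freud1 k z = 0)) \<and> (\<forall>z\<in>D. freud2 k z = 0)"
proof (induction k)
  case 0
  then show ?case using riccati
    by (auto simp: freud1_def freud2_def s0 b0 b'0 algebra_simps)
next
  case (Suc k)
  then have "\<forall>z\<in>D. freud2 (Suc k) z = 0" using freud2_Suc by (meson Suc_leD Suc_le_lessD)
  with Suc show ?case using freud1_Suc[of k] by auto
qed

text \<open>Times z, the values at k and k+1 reduce to the same polynomial in z, s_k, a_k, b_k: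
  \<open>freud2\<close> removes \<open>b'\<close> and a_(k+1), then \<open>freud1\<close> removes
  b_(k+1).\<close>

lemma residue_det_Suc:
  assumes k: "Suc k \<le> n" and z: "z \<in> D" and residue_det: "residue_det k z = 0"
  shows "residue_det (Suc k) z = 0"
proof -
  have freud1: "freud1 k z = 0" and freud2: "freud2 k z = 0" and freud2': "freud2 (Suc k) z = 0"
    using freud1_freud2[of k] freud1_freud2[of "Suc k"] k z by auto
  have "a k z = s (Suc k) z - s k z" by (rule a_def)
  then have sS: "s (Suc k) z = s k z + a k z" by simp
  \<comment> \<open>The first factor in \<open>residue_det k\<close>; by the Toda formula the second
    factor in \<open>residue_det (Suc k)\<close> is \<open>b (Suc k) z * ?Z\<close>.\<close>
  let ?Z = "z * a k z + \<alpha> + 2 * of_nat k"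
  define W where "W = z * b (Suc k) z"
  define V where "V = z * b k z"
  have W: "W = - (2 * (s k z + of_nat k * a k z - of_nat k) + z * (a k z)\<^sup>2 + V
     + (\<alpha> + 1 - z) * a k z + N)"
    using freud1 unfolding freud1_def W_def V_def by (simp add: algebra_simps add_eq_0_iff)
  have "z * residue_det (Suc k) z = ?Z * freud2 (Suc k) z
     + ?Z * ((\<alpha> + 2 * of_nat k + 1) * (s k z + a k z) + (of_nat k + 1) * (N - of_nat k) - W * (?Z - \<alpha> - 2 * of_nat k - 1 - z))
     - z * (s k z + a k z + W) * (s k z + a k z + W + N + \<alpha>)"
    unfolding freud2_def residue_det_def W_def sS b'_Suc[OF k z] by (simp add: algebra_simps)
  moreover have "z * residue_det k z = ?Z * freud2 k z
     + ?Z * ((\<alpha> + 2 * of_nat k - 1) * s k z + of_nat k * (N - of_nat k + 1) - V * (?Z + 1 - \<alpha> - 2 * of_nat k - z))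
     - z * (s k z + V) * (s k z + V + N + \<alpha>)"
    unfolding freud2_def residue_det_def V_def by (simp add: algebra_simps)
  moreover have "?Z * ((\<alpha> + 2 * of_nat k + 1) * (s k z + a k z) + (of_nat k + 1) * (N - of_nat k) - W * (?Z - \<alpha> - 2 * of_nat k - 1 - z))
     - z * (s k z + a k z + W) * (s k z + a k z + W + N + \<alpha>)
    = ?Z * ((\<alpha> + 2 * of_nat k - 1) * s k z + of_nat k * (N - of_nat k + 1) - V * (?Z + 1 - \<alpha> - 2 * of_nat k - z))
     - z * (s k z + V) * (s k z + V + N + \<alpha>)"
    unfolding W by (simp add: algebra_simps power2_eq_square)
  ultimately have "z * residue_det (Suc k) z = 0" using freud2 freud2' residue_det by simp
  then show ?thesis using nz[OF z] by simp
qed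

lemma residue_det_zero: "k \<le> n \<Longrightarrow> z \<in> D \<Longrightarrow> residue_det k z = 0"
proof (induction k)
  case 0
  then show ?case by (simp add: residue_det_def s0 b0 b'0)
next
  case (Suc k)
  then show ?case using residue_det_Suc by simp
qed

text \<open>In Z = z a_n + \<alpha> + 2n, \<open>residue_det n\<close> is the quadratic b Z^2 -
  \<sigma>'' Z - \<sigma>' (\<sigma>' + N + \<alpha>), and \<open>freud2 n\<close> gives the value
  of its derivative 2 b Z - \<sigma>''. At a root the square of the derivative is the discriminant,
  which eliminates a_n.\<close>

lemma sigma_identity:
  assumes z: "z \<in> D"
  defines "\<sigma> \<equiv> z * s n z - of_nat n * (N - of_nat n + 1)"
    and "\<sigma>' \<equiv> s n z + z * b n z" and "\<sigma>'' \<equiv> 2 * b n z + z * b' n z"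
  shows "(z * \<sigma>'')\<^sup>2 = (2 * \<sigma>'\<^sup>2 + (2 * (N - of_nat n) + 1 + \<alpha> - z) * \<sigma>' + \<sigma>)\<^sup>2
    - 4 * \<sigma>' * ((\<sigma>' + (N - of_nat n + 1)) * (\<sigma>' - of_nat n) * (\<sigma>' + (N + \<alpha>)))"
proof -
  let ?Z = "z * a n z + \<alpha> + 2 * of_nat n"
  have freud2: "freud2 n z = 0" and residue_det: "residue_det n z = 0" using freud1_freud2[of n] residue_det_zero z by auto
  have "z * (2 * b n z * ?Z - 2 * b n z - z * b' n z) = freud2 n z + ((\<alpha> + 2 * of_nat n - 1 + z) * \<sigma>' - \<sigma>)"
    unfolding freud2_def \<sigma>_def \<sigma>'_def by (simp add: algebra_simps)
  moreover have "(z * \<sigma>'')\<^sup>2 = (z * (2 * b n z * ?Z - 2 * b n z - z * b' n z))\<^sup>2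
      - 4 * z\<^sup>2 * b n z * (residue_det n z + \<sigma>' * (\<sigma>' + N + \<alpha>))"
    unfolding residue_det_def \<sigma>'_def \<sigma>''_def by (simp add: algebra_simps power2_eq_square)
  moreover have "z\<^sup>2 * b n z = z * \<sigma>' - \<sigma> - of_nat n * (N - of_nat n + 1)"
    unfolding \<sigma>_def \<sigma>'_def by (simp add: algebra_simps power2_eq_square)
  ultimately have "(z * \<sigma>'')\<^sup>2 = ((\<alpha> + 2 * of_nat n - 1 + z) * \<sigma>' - \<sigma>)\<^sup>2
      - 4 * (z * \<sigma>' - \<sigma> - of_nat n * (N - of_nat n + 1)) * (\<sigma>' * (\<sigma>' + N + \<alpha>))"
    using freud2 residue_det by (simp add: mult.assoc)
  also have "\<dots> = (2 * \<sigma>'\<^sup>2 + (2 * (N - of_nat n) + 1 + \<alpha> - z) * \<sigma>' + \<sigma>)\<^sup>2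
    - 4 * \<sigma>' * ((\<sigma>' + (N - of_nat n + 1)) * (\<sigma>' - of_nat n) * (\<sigma>' + (N + \<alpha>)))"
    by (simp add: algebra_simps power2_eq_square)
  finally show ?thesis .
qed

end

section \<open>Laguerre polynomials and their Toda data\<close>

lemma coeff_laguerre:
  "coeff (laguerre N \<alpha>) i =
    (if i \<le> N then (-1) ^ i / (fact i * fact (N - i)) * (\<Prod>l=i+1..N. \<alpha> + of_nat l) else 0)"
proof -
  have "coeff (laguerre N \<alpha>) i = (\<Sum>j=0..N. if j = i then
      (-1) ^ j / (fact j * fact (N - j)) * (\<Prod>l=j+1..N. \<alpha> + of_nat l) else 0)"
    unfolding laguerre_def coeff_sum coeff_monom ..
  then show ?thesis by simp
qed

text \<open>The leading coefficient (-1)^N / N! does not involve \<alpha>, so no value of \<alpha>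
  is exceptional.\<close>

lemma degree_laguerre: "degree (laguerre N \<alpha>) = N"
proof (rule antisym)
  show "degree (laguerre N \<alpha>) \<le> N" by (rule degree_le) (simp add: coeff_laguerre)
  show "N \<le> degree (laguerre N \<alpha>)" by (rule le_degree) (simp add: coeff_laguerre)
qed

lemma laguerre_nonzero: "laguerre N \<alpha> \<noteq> 0"
proof -
  have "coeff (laguerre N \<alpha>) N \<noteq> 0" by (simp add: coeff_laguerre)
  then show ?thesis by force
qed

text \<open>The Laguerre equation read off coefficientwise, kept free of division because \<alpha> +
  1 + i may vanish.\<close>

lemma coeff_laguerre_Suc:
  "of_nat (Suc i) * (\<alpha> + 1 + of_nat i) * coeff (laguerre N \<alpha>) (Suc i) =
    - (of_nat N - of_nat i) * coeff (laguerre N \<alpha>) i"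
proof (cases "i < N")
  case True
  then obtain j where j: "N = i + Suc j" using less_iff_Suc_add by auto
  have "(\<Prod>l=i+1..N. \<alpha> + of_nat l) = (\<alpha> + 1 + of_nat i) * (\<Prod>l=Suc i+1..N. \<alpha> + of_nat l)"
    using True by (subst prod.atLeast_Suc_atMost) (auto simp: algebra_simps)
  then have ci: "coeff (laguerre N \<alpha>) i = (-1) ^ i / (fact i * fact (Suc j)) *
      ((\<alpha> + 1 + of_nat i) * (\<Prod>l=Suc i+1..N. \<alpha> + of_nat l))"
    using True j by (simp add: coeff_laguerre)
  have cSi: "coeff (laguerre N \<alpha>) (Suc i) = (-1) ^ Suc i / (fact (Suc i) * fact j) *
      (\<Prod>l=Suc i+1..N. \<alpha> + of_nat l)"
    using j by (simp add: coeff_laguerre)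
  have ratio: "of_nat (Suc i) * ((-1) ^ Suc i / (fact (Suc i) * fact j)) =
      - (of_nat N - of_nat i) * ((-1) ^ i / (fact i * fact (Suc j)) :: complex)"
  proof -
    have "of_nat N - of_nat i = (of_nat (Suc j) :: complex)" using j by simp
    moreover have "(of_nat (Suc i) :: complex) \<noteq> 0" "(of_nat (Suc j) :: complex) \<noteq> 0"
      by (simp_all del: of_nat_Suc)
    ultimately show ?thesis by (simp add: fact_Suc del: of_nat_Suc)
  qed
  show ?thesis
    unfolding ci cSi mult.assoc[symmetric] ratio[symmetric] by (simp only: mult_ac)
next
  case False
  then show ?thesis by (cases "i = N") (auto simp: coeff_laguerre)
qed

lemma laguerre_ode:
  "z * poly (pderiv (pderiv (laguerre N \<alpha>))) z + (\<alpha> + 1 - z) * poly (pderiv (laguerre N \<alpha>)) z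
    + of_nat N * poly (laguerre N \<alpha>) z = 0"
proof -
  let ?w = "laguerre N \<alpha>"
  have "pCons 0 (pderiv (pderiv ?w)) + Polynomial.smult (\<alpha> + 1) (pderiv ?w) - pCons 0 (pderiv ?w)
      + Polynomial.smult (of_nat N) ?w = 0"
  proof (rule poly_eqI)
    fix i
    show "coeff (pCons 0 (pderiv (pderiv ?w)) + Polynomial.smult (\<alpha> + 1) (pderiv ?w) - pCons 0 (pderiv ?w)
        + Polynomial.smult (of_nat N) ?w) i = coeff 0 i"
    proof -
      have "coeff (pCons 0 (pderiv (pderiv ?w)) + Polynomial.smult (\<alpha> + 1) (pderiv ?w) - pCons 0 (pderiv ?w)
          + Polynomial.smult (of_nat N) ?w) i =
        of_nat (Suc i) * (\<alpha> + 1 + of_nat i) * coeff ?w (Suc i) + (of_nat N - of_nat i) * coeff ?w i"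
        by (cases i) (simp_all add: coeff_pderiv algebra_simps)
      then show ?thesis unfolding coeff_laguerre_Suc by (simp add: algebra_simps)
    qed
  qed
  from arg_cong[OF this, of "\<lambda>p. poly p z"] show ?thesis by (simp add: algebra_simps)
qed

text \<open>The case split in \<open>b\<close> encodes T_(-1) = 0: truncated subtraction would turn
  \<open>T (k - 1)\<close> into T_0 at k = 0.\<close>

lemma laguerre_toda_hankel_tau:
  fixes \<alpha> :: complex
  assumes n: "n \<le> N"
  defines "T \<equiv> hankel_tau (laguerre N \<alpha>)"
  defines "s \<equiv> \<lambda>k z. poly (pderiv (T k)) z / poly (T k) z"
  defines "a \<equiv> \<lambda>k z. s (Suc k) z - s k z"
  defines "b \<equiv> \<lambda>k z. if k = 0 then 0 else poly (T (k + 1)) z * poly (T (k - 1)) z / (poly (T k) z)\<^sup>2"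
  defines "b' \<equiv> \<lambda>k z. if k = 0 then 0 else b k z * (a k z - a (k - 1) z)"
  defines "D \<equiv> {z. z \<noteq> 0 \<and> (\<forall>k\<le>Suc n. poly (T k) z \<noteq> 0)}"
  shows "laguerre_toda D s a b b' \<alpha> (of_nat N) n"
proof
  have D: "D = (\<Inter>k\<in>{..Suc n}. {z. poly (T k) z \<noteq> 0}) - {0}"
    by (auto simp: D_def)
  show "open D" unfolding D
    by (intro open_Diff open_INT ballI open_Collect_neq continuous_intros) auto
  show "z \<noteq> 0" if "z \<in> D" for z using that by (simp add: D_def)
  have Tnz: "poly (T k) z \<noteq> 0" if "k \<le> Suc n" "z \<in> D" for k z using that by (auto simp: D_def)
  have toda: "poly (T (Suc (Suc k))) z * poly (T k) z =
      poly (T (Suc k)) z * poly (pderiv (pderiv (T (Suc k)))) z - (poly (pderiv (T (Suc k))) z)\<^sup>2" for k z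
    using arg_cong[OF hankel_tau_toda[of "laguerre N \<alpha>" k], of "\<lambda>p. poly p z"]
    by (simp add: T_def)
  have s0: "s 0 = (\<lambda>z. 0)" by (simp add: s_def T_def)
  then show "s 0 z = 0" for z by simp
  show "b 0 z = 0" "b' 0 z = 0" for z by (simp_all add: b_def b'_def)
  show "a k z = s (Suc k) z - s k z" for k z by (simp add: a_def)
  show "b' (Suc k) z = b (Suc k) z * (a (Suc k) z - a k z)" for k z by (simp add: b'_def)
  show "b (Suc k) z \<noteq> 0" if "Suc k \<le> n" "z \<in> D" for k z
    using that Tnz by (simp add: b_def)
  show "(s k has_field_derivative b k z) (at z)" if "k \<le> n" "z \<in> D" for k z
  proof (cases k)
    case 0
    then show ?thesis by (simp add: s0 b_def)
  next
    case (Suc j)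
    have "poly (T k) z \<noteq> 0" using Tnz that by simp
    then show ?thesis
      unfolding s_def b_def Suc using toda[of j z]
      by (auto intro!: derivative_eq_intros poly_DERIV simp: power2_eq_square mult.commute)
  qed
  show "(b k has_field_derivative b' k z) (at z)" if "k \<le> n" "z \<in> D" for k z
  proof (cases k)
    case 0
    then have "b k = (\<lambda>z. 0)" "b' k z = 0" by (auto simp: b_def b'_def)
    then show ?thesis by simp
  next
    case (Suc j)
    have bk: "b k = (\<lambda>z. poly (T (Suc (Suc j))) z * poly (T j) z / (poly (T (Suc j)) z)\<^sup>2)"
      using Suc by (auto simp: b_def)
    have "poly (T j) z \<noteq> 0" "poly (T (Suc j)) z \<noteq> 0" "poly (T (Suc (Suc j))) z \<noteq> 0"
      using Tnz that Suc by auto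
    \<comment> \<open>Logarithmic differentiation: b_k'/b_k = s_(k+1) + s_(k-1) - 2 s_k = a_k -
      a_(k-1).\<close>
    then show ?thesis
      unfolding bk b'_def a_def s_def Suc
      by (auto intro!: derivative_eq_intros poly_DERIV simp: divide_simps power2_eq_square b_def)
        (simp add: algebra_simps)
  qed
  show "z * (b 1 z + (a 0 z)\<^sup>2) + (\<alpha> + 1 - z) * a 0 z + of_nat N = 0" if "z \<in> D" for z
  proof -
    let ?w = "laguerre N \<alpha>"
    have w: "poly ?w z \<noteq> 0" using Tnz[of 1 z] that by (simp add: T_def)
    have "b 1 z + (a 0 z)\<^sup>2 = poly (pderiv (pderiv ?w)) z / poly ?w z"
      using w toda[of 0 z]
      by (simp add: b_def a_def s_def T_def divide_simps power2_eq_square numeral_2_eq_2 algebra_simps)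
    moreover have "a 0 z = poly (pderiv ?w) z / poly ?w z" by (simp add: a_def s_def T_def)
    ultimately have "z * (b 1 z + (a 0 z)\<^sup>2) + (\<alpha> + 1 - z) * a 0 z + of_nat N =
        (z * poly (pderiv (pderiv ?w)) z + (\<alpha> + 1 - z) * poly (pderiv ?w) z + of_nat N * poly ?w z) / poly ?w z"
      using w by (simp add: add_divide_distrib)
    then show ?thesis by (simp add: laguerre_ode)
  qed
qed

section \<open>Excluded points and the sigma equation\<close>

lemma continuous_eq_0_cofinite:
  fixes F :: "complex \<Rightarrow> complex"
  assumes "open S" "continuous_on S F" "finite B" "\<And>z. z \<in> S - B \<Longrightarrow> F z = 0" "z \<in> S"
  shows "F z = 0"
proof -
  have "open (S - (B - {z}))" using assms by (intro open_Diff finite_imp_closed) auto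
  then have "eventually (\<lambda>y. y \<in> (S - (B - {z})) - {z}) (at z)"
    using assms(5) by (intro eventually_at_in_open) auto
  then have "eventually (\<lambda>y. F y = 0) (at z)"
    by eventually_elim (use assms(4) in auto)
  then have "(F \<longlongrightarrow> 0) (at z)" by (simp add: tendsto_eventually)
  moreover have "(F \<longlongrightarrow> F z) (at z)"
    using assms continuous_on_eq_continuous_at isContD by blast
  ultimately show ?thesis using LIM_unique by blast
qed

text \<open>The first conjunct makes the set of the second one cofinite, so the solution claim is
  not vacuous.\<close>

theorem theorem5p2:
  fixes \<mu> :: complex and m n :: nat
  assumes "n \<ge> 1"
  shows "gen_laguerre m n \<mu> \<noteq> 0 \<and>
    PV_sigma_solution_on (of_nat m + 1) (- of_nat n) (of_nat m + of_nat n + \<mu> + 1)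
      (sigma_fun m n \<mu>) {z. poly (gen_laguerre m n \<mu>) z \<noteq> 0}"
proof -
  define N where "N = m + n"
  define T where "T = hankel_tau (laguerre N (\<mu> + 1))"
  have gen: "gen_laguerre m n \<mu> = T n"
    by (simp add: gen_laguerre_def T_def hankel_tau_def N_def)
  \<comment> \<open>Size n+1 is included since a_n involves it; for m = 0 it is N+1, where the
    determinant is a nonzero constant.\<close>
  have Tnz: "T k \<noteq> 0" if "k \<le> Suc n" for k
    using hankel_tau_degree[OF degree_laguerre laguerre_nonzero] that
    by (simp add: T_def N_def)
  define s where "s k z = poly (pderiv (T k)) z / poly (T k) z" for k z
  define a where "a k z = s (Suc k) z - s k z" for k z
  define b where "b k z = (if k = 0 then 0 else poly (T (k + 1)) z * poly (T (k - 1)) z / (poly (T k) z)\<^sup>2)" for k z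
  define b' where "b' k z = (if k = 0 then 0 else b k z * (a k z - a (k - 1) z))" for k z
  define D where "D = {z. z \<noteq> 0 \<and> (\<forall>k\<le>Suc n. poly (T k) z \<noteq> 0)}"
  define S where "S = {z. poly (T n) z \<noteq> 0}"
  have "laguerre_toda D s a b b' (\<mu> + 1) (of_nat N) n"
    using laguerre_toda_hankel_tau[of n N "\<mu> + 1"]
    unfolding D_def s_def a_def b_def b'_def T_def N_def by simp
  then interpret laguerre_toda D s a b b' "\<mu> + 1" "of_nat N" n .
  define \<sigma> where "\<sigma> = sigma_fun m n \<mu>"
  have \<sigma>: "\<sigma> = (\<lambda>z. z * s n z - (of_nat m + 1) * of_nat n)"
    by (auto simp: \<sigma>_def sigma_fun_def gen s_def)
  have S: "open S" unfolding S_def by (intro open_Collect_neq continuous_intros)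
  have hol: "\<sigma> holomorphic_on S"
    unfolding \<sigma> s_def S_def by (intro holomorphic_intros) auto
  then have hol': "deriv \<sigma> holomorphic_on S" and hol'': "deriv (deriv \<sigma>) holomorphic_on S"
    using S by (auto intro!: holomorphic_deriv)
  have \<sigma>': "deriv \<sigma> z = s n z + z * b n z" if "z \<in> D" for z
  proof (rule DERIV_imp_deriv)
    show "(\<sigma> has_field_derivative s n z + z * b n z) (at z)"
      unfolding \<sigma> using that by (auto intro!: derivative_eq_intros s_deriv)
  qed
  have \<sigma>'': "deriv (deriv \<sigma>) z = 2 * b n z + z * b' n z" if "z \<in> D" for z
  proof (rule DERIV_imp_deriv)
    have "((\<lambda>z. s n z + z * b n z) has_field_derivative 2 * b n z + z * b' n z) (at z)"
      using that by (auto intro!: derivative_eq_intros s_deriv b_deriv)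
    then show "(deriv \<sigma> has_field_derivative 2 * b n z + z * b' n z) (at z)"
      by (rule has_field_derivative_transform_within_open) (use open_D that \<sigma>' in auto)
  qed
  define F where "F z = (z * deriv (deriv \<sigma>) z)\<^sup>2 -
      ((2 * (deriv \<sigma> z)\<^sup>2 + ((of_nat m + 1) + (- of_nat n) + (of_nat m + of_nat n + \<mu> + 1) - z) * deriv \<sigma> z + \<sigma> z)\<^sup>2
      - 4 * deriv \<sigma> z * ((deriv \<sigma> z + (of_nat m + 1)) * (deriv \<sigma> z + (- of_nat n)) * (deriv \<sigma> z + (of_nat m + of_nat n + \<mu> + 1))))" for z
  have "continuous_on S F"
    unfolding F_def by (intro continuous_intros holomorphic_on_imp_continuous_on hol hol' hol'')
  \<comment> \<open>Outside \<open>B\<close> the Toda argument applies. At points of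
    \<open>B\<close> in \<open>S\<close> only its divisions may fail, while \<sigma> stays
    holomorphic.\<close>
  moreover define B where "B = {0} \<union> (\<Union>k\<in>{..Suc n}. {z. poly (T k) z = 0})"
  moreover have "finite B" unfolding B_def using Tnz by (auto intro!: poly_roots_finite)
  moreover have "F z = 0" if "z \<in> S - B" for z
  proof -
    have z: "z \<in> D" using that by (auto simp: B_def D_def)
    have \<sigma>z: "\<sigma> z = z * s n z - of_nat n * (of_nat N - of_nat n + 1)"
      by (simp add: \<sigma> N_def algebra_simps)
    have sum_\<nu>: "of_nat m + 1 + - of_nat n + (of_nat m + of_nat n + \<mu> + 1) = 2 * (of_nat N - of_nat n) + 1 + (\<mu> + 1)"
      and \<nu>1: "of_nat m + 1 = (of_nat N - of_nat n + 1 :: complex)"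
      and \<nu>3: "of_nat m + of_nat n + \<mu> + 1 = of_nat N + (\<mu> + 1)"
      by (simp_all add: N_def algebra_simps)
    show ?thesis
      unfolding F_def \<sigma>'[OF z] \<sigma>''[OF z] \<sigma>z sum_\<nu> unfolding \<nu>1 \<nu>3
      using sigma_identity[OF z] by (simp only: add_uminus_conv_diff right_minus_eq)
  qed
  ultimately have "F z = 0" if "z \<in> S" for z
    using continuous_eq_0_cofinite[OF S] that by blast
  then have "PV_sigma_solution_on (of_nat m + 1) (- of_nat n) (of_nat m + of_nat n + \<mu> + 1) \<sigma> S"
    unfolding PV_sigma_solution_on_def F_def using S hol by auto
  then show ?thesis using Tnz[of n] unfolding gen \<sigma>_def S_def by simp
qed

end
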